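(* Let $\ell_o>0$, $\ell_c\ge0$, $0<t_e<1$, $t_d=1-t_e$. For $r>0$ let $$\epsilon(r)=t_e\left(\frac{\gamma_2P}{r^{\alpha}}+\frac32\frac{\gamma_4P^2}{r^{2\alpha}}\right),\qquad \epsilon_o(r)=\left(2^{\frac{\ell_o}{t_dB}}-1\right)t_d\sigma^2r^{\alpha},\qquad \epsilon_c=\xi\psi^3\ell_c^3 .$$ Then the maximum distance up to which the device can offload $\ell_o$ bits and locally compute $\ell_c$ bits successfully with deterministic fading, i.e. $r_{\max}=\sup\{r>0:\epsilon(r)>\epsilon_o(r)+\epsilon_c\}$, is $$r_{\max}=\left(u+\left(v-\sqrt{v^2+(w-u^2)^3}\right)^{1/3}+\left(v+\sqrt{v^2+(w-u^2)^3}\right)^{1/3}\right)^{1/\alpha},$$ where $$u=-\frac{b}{3a},\quad v=u^3+\frac{bc-3ad}{6a^2},\quad w=\frac{c}{3a},$$ $$a=\left(2^{\frac{\ell_o}{t_dB}}-1\right)t_d\sigma^2,\quad b=\ell_c^3\xi\psi^3,\quad c=-t_e\gamma_2P,\quad d=-\tfrac32t_e\gamma_4P^2 .$$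
   Context: Deterministic fading means that the channel coefficients satisfy $|h|=|g|=1$ in the harvested energy $t_e(\gamma_2Pr^{-\alpha}|h|^2+\frac32\gamma_4P^2r^{-2\alpha}|h|^4)$ and in the energy $t_d(2^{\ell_o/(t_dB)}-1)\sigma^2r^{\alpha}/|g|^2$ required to offload $\ell_o$ bits; $\epsilon_c$ is the energy required to compute $\ell_c$ bits locally. The computation is successful when the harvested energy exceeds the required energy. The constants $P,B,\sigma^2,\xi,\psi,\gamma_2,\gamma_4$ are positive reals and $\alpha>2$. The square and cube roots in the formula are principal complex roots (so that, when $v^2+(w-u^2)^3<0$, the two cube roots are complex conjugates of each other). *)

theory Defs
  imports "HOL-Analysis.Analysis"
begin

text \<open>
  On complex numbers, \<^term>\<open>csqrt\<close> is the principal square root, and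
  \<^term>\<open>z powr (1 / 3)\<close> is the principal cube root of a nonzero \<open>z\<close>,
  since \<^term>\<open>Ln\<close> has imaginary part in \<open>(-pi, pi]\<close>.
  (Unlike \<^term>\<open>root 3\<close>, this is not real on the negative real axis.)
\<close>

definition cbrt :: "complex \<Rightarrow> complex" where
  "cbrt z = z powr (1 / 3)"

end

theory Submission
  imports Defs
begin

text \<open>
  In \<open>x = r powr \<alpha>\<close> the success condition reads \<open>a x\<^sup>3 + b x\<^sup>2 + c x + d < 0\<close>, with
  \<open>a > 0\<close>, \<open>b \<ge> 0\<close>, \<open>c, d < 0\<close>. Such a cubic has exactly one positive root \<open>X\<close>, which is
  simple, and it is negative on \<open>(0, X)\<close>. Shifting by \<open>u \<le> 0\<close> gives the depressed cubic
  \<open>y\<^sup>3 - 3 m\<^sup>2 y - 2 v\<close> with \<open>m = sqrt (u\<^sup>2 - w) > 0\<close>; its derivative is positive at the positive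
  root \<open>Y = X - u\<close>, so \<open>Y > m\<close>. This inequality decides which branches of the cube roots occur:
  if \<open>Y < 2 m\<close>, then \<open>Y = 2 m cos \<phi>\<close> with \<open>0 < \<phi> < pi / 3\<close> and the cube roots are
  \<open>m exp (\<plusminus> \<i> \<phi>)\<close>; otherwise \<open>Y = t + m\<^sup>2 / t\<close> with \<open>t \<ge> m\<close> and the cube roots are the
  positive reals \<open>t\<close> and \<open>m\<^sup>2 / t\<close>.
\<close>

text \<open>The bound puts the imaginary part of \<open>3 * z\<close> strictly between
  \<open>-pi\<close> and \<open>pi\<close>, where \<open>Ln\<close> inverts \<open>exp\<close>.
  Beyond it the principal root could land on another branch.\<close>

lemma cbrt_exp_cube:
  assumes "\<bar>Im z\<bar> < pi / 3"
  shows "cbrt (exp z ^ 3) = exp z"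
proof -
  have "exp z ^ 3 = exp (3 * z)"
    using exp_of_nat_mult[of 3 z] by simp
  moreover have "Ln (exp (3 * z)) = 3 * z"
    using assms by (intro Ln_exp) auto
  ultimately show ?thesis
    by (simp add: cbrt_def powr_def)
qed

lemma cbrt_of_real_cube:
  fixes t :: real
  assumes "t > 0"
  shows "cbrt (of_real (t ^ 3)) = of_real t"
proof -
  have "of_real t = exp (of_real (ln t) :: complex)"
    using assms by (simp add: exp_of_real)
  then show ?thesis
    using cbrt_exp_cube[of "of_real (ln t)"] by simp
qed

lemma cbrt_rcis_cube:
  assumes "m > 0" "\<bar>\<phi>\<bar> < pi / 3"
  shows "cbrt (rcis (m ^ 3) (3 * \<phi>)) = rcis m \<phi>"
proof -
  have "rcis m \<phi> = exp (Complex (ln m) \<phi>)"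
    using assms by (simp add: exp_eq_polar rcis_def flip: cis_conv_exp)
  moreover have "rcis (m ^ 3) (3 * \<phi>) = rcis m \<phi> ^ 3"
    by (simp add: DeMoivre2)
  ultimately show ?thesis
    using cbrt_exp_cube[of "Complex (ln m) \<phi>"] assms by simp
qed

lemma cardano_complex_case:
  fixes m Y v :: real
  assumes m: "m > 0" and Y: "m < Y" "Y < 2 * m" and v: "2 * v = Y ^ 3 - 3 * m\<^sup>2 * Y"
  shows "cbrt (of_real v - csqrt (of_real (v\<^sup>2 - m ^ 6)))
       + cbrt (of_real v + csqrt (of_real (v\<^sup>2 - m ^ 6))) = of_real Y"
proof -
  define \<phi> where "\<phi> = arccos (Y / (2 * m))"
  have bnd: "1 / 2 < Y / (2 * m)" "Y / (2 * m) < 1"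
    using m Y by (auto simp: field_simps)
  have cos: "cos \<phi> = Y / (2 * m)"
    unfolding \<phi>_def using bnd by (intro cos_arccos) auto
  \<comment> \<open>The bound \<open>m < Y\<close> gives the angle range in which
    \<open>cbrt\<close> undoes cubing; \<open>Y < 2 * m\<close> gives \<phi> > 0.\<close>
  have "\<phi> < arccos (1 / 2)"
    unfolding \<phi>_def using bnd by (intro arccos_less_arccos) auto
  moreover have "arccos (1 / 2) = pi / 3"
    by (simp add: arccos_unique cos_60)
  moreover have "arccos 1 < \<phi>"
    unfolding \<phi>_def using bnd by (intro arccos_less_arccos) auto
  ultimately have \<phi>: "0 < \<phi>" "\<phi> < pi / 3"
    by auto
  have YC: "Y = 2 * m * cos \<phi>"
    using cos m by simp
  have "2 * v = 2 * m ^ 3 * (4 * cos \<phi> ^ 3 - 3 * cos \<phi>)"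
    unfolding v YC by (simp add: algebra_simps power2_eq_square power3_eq_cube)
  then have vC: "v = m ^ 3 * cos (3 * \<phi>)"
    by (simp add: cos_treble_cos)
  have "v\<^sup>2 - m ^ 6 = (m ^ 3)\<^sup>2 * ((cos (3 * \<phi>))\<^sup>2 - 1)"
    by (simp add: vC algebra_simps)
  then have D: "v\<^sup>2 - m ^ 6 = - ((m ^ 3 * sin (3 * \<phi>))\<^sup>2)"
    by (simp add: cos_squared_eq algebra_simps)
  \<comment> \<open>This sign decides which of the two imaginary square roots is
    \<open>csqrt\<close>.\<close>
  have "sin (3 * \<phi>) > 0"
    using \<phi> by (intro sin_gt_zero) auto
  then have "csqrt (of_real (v\<^sup>2 - m ^ 6)) = \<i> * of_real (m ^ 3 * sin (3 * \<phi>))"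
    unfolding D using m by (subst csqrt_of_real_nonpos) (auto simp: abs_mult)
  then have "of_real v + csqrt (of_real (v\<^sup>2 - m ^ 6)) = rcis (m ^ 3) (3 * \<phi>)"
    and "of_real v - csqrt (of_real (v\<^sup>2 - m ^ 6)) = rcis (m ^ 3) (3 * - \<phi>)"
    by (simp_all add: vC complex_eq_iff)
  then have "cbrt (of_real v - csqrt (of_real (v\<^sup>2 - m ^ 6)))
       + cbrt (of_real v + csqrt (of_real (v\<^sup>2 - m ^ 6))) = rcis m (- \<phi>) + rcis m \<phi>"
    using cbrt_rcis_cube[of m \<phi>] cbrt_rcis_cube[of m "- \<phi>"] m \<phi> by simp
  also have "\<dots> = of_real Y"
    by (simp add: complex_eq_iff YC)
  finally show ?thesis .
qed

lemma cardano_real_case: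
  fixes m Y v :: real
  assumes m: "m > 0" and Y: "2 * m \<le> Y" and v: "2 * v = Y ^ 3 - 3 * m\<^sup>2 * Y"
  shows "cbrt (of_real v - csqrt (of_real (v\<^sup>2 - m ^ 6)))
       + cbrt (of_real v + csqrt (of_real (v\<^sup>2 - m ^ 6))) = of_real Y"
proof -
  \<comment> \<open>\<open>s\<close> and \<open>t\<close> are the roots of
    \<open>z\<^sup>2 - Y * z + m\<^sup>2\<close>, real because \<open>2 * m \<le> Y\<close>. Their
    cubes have sum \<open>2 * v\<close> and product \<open>m ^ 6\<close>, so they are the two
    radicands of Cardano's formula.\<close>
  define k where "k = sqrt (Y\<^sup>2 - 4 * m\<^sup>2)"
  define s t where "s = (Y - k) / 2" and "t = (Y + k) / 2"
  have "(2 * m)\<^sup>2 \<le> Y\<^sup>2"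
    using m Y by (intro power_mono) auto
  then have k: "k\<^sup>2 = Y\<^sup>2 - 4 * m\<^sup>2" "0 \<le> k"
    by (auto simp: k_def power_mult_distrib)
  then have "k\<^sup>2 < Y\<^sup>2"
    using m by simp
  then have "k < Y"
    using m Y by (simp add: power_less_imp_less_base)
  then have st: "0 < s" "s \<le> t" "0 < t"
    using k m Y by (auto simp: s_def t_def)
  have prod: "s * t = m\<^sup>2" and sum: "s + t = Y"
    using k by (auto simp: s_def t_def field_simps power2_eq_square)
  have v': "v = (t ^ 3 + s ^ 3) / 2"
    using v unfolding prod[symmetric] sum[symmetric]
    by (simp add: algebra_simps power2_eq_square power3_eq_cube)
  have "m ^ 6 = (m\<^sup>2) ^ 3"
    by simp
  then have "m ^ 6 = (s * t) ^ 3"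
    by (simp only: prod)
  then have D: "v\<^sup>2 - m ^ 6 = ((t ^ 3 - s ^ 3) / 2)\<^sup>2"
    by (simp add: v' power2_eq_square power_mult_distrib field_simps)
  have "s ^ 3 \<le> t ^ 3"
    using st by (intro power_mono) auto
  then have "csqrt (of_real (v\<^sup>2 - m ^ 6)) = of_real ((t ^ 3 - s ^ 3) / 2)"
    unfolding D by (subst csqrt_of_real_nonneg) (auto simp del: of_real_diff of_real_divide)
  then have "of_real v - csqrt (of_real (v\<^sup>2 - m ^ 6)) = of_real (s ^ 3)"
    and "of_real v + csqrt (of_real (v\<^sup>2 - m ^ 6)) = of_real (t ^ 3)"
    by (simp_all add: v' complex_eq_iff field_simps)
  then show ?thesis
    using st sum by (simp only: cbrt_of_real_cube flip: of_real_add)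
qed

text \<open>The condition \<open>Y\<^sup>2 + q > 0\<close> is positivity of the derivative at
  \<open>Y\<close>. It singles out a root with \<open>Y > m\<close>, and for such a root comparing
  \<open>Y\<close> with \<open>2 * m\<close> amounts to testing the sign of the discriminant
  \<open>v\<^sup>2 + q ^ 3\<close>.\<close>

lemma cardano_principal_roots:
  fixes q Y v :: real
  assumes "q < 0" "Y > 0" "Y\<^sup>2 + q > 0" and root: "Y ^ 3 + 3 * q * Y - 2 * v = 0"
  shows "cbrt (of_real v - csqrt (of_real (v\<^sup>2 + q ^ 3)))
       + cbrt (of_real v + csqrt (of_real (v\<^sup>2 + q ^ 3))) = of_real Y"
proof -
  define m where "m = sqrt (- q)"
  have m: "m > 0" and q: "q = - (m\<^sup>2)"
    using assms by (auto simp: m_def)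
  have v: "2 * v = Y ^ 3 - 3 * m\<^sup>2 * Y" and Y: "m < Y"
    using assms q by (auto intro: power_less_imp_less_base[of m 2 Y])
  have "v\<^sup>2 + q ^ 3 = v\<^sup>2 - m ^ 6"
    by (simp add: q flip: power_mult)
  then show ?thesis
    using cardano_complex_case[OF m Y _ v] cardano_real_case[OF m _ v] by (cases "Y < 2 * m") auto
qed

lemma cubic_positive_root_exists:
  fixes a b c d :: real
  assumes "a > 0" "b \<ge> 0" "c < 0" "d < 0"
  obtains X where "X > 0" "a * X ^ 3 + b * X\<^sup>2 + c * X + d = 0"
proof -
  define p where "p x = a * x ^ 3 + b * x\<^sup>2 + c * x + d" for x
  \<comment> \<open>Chosen so that \<open>a * N ^ 3\<close> supplies the surplus
    \<open>(- c - d) * N\<^sup>2\<close>, which outweighs the negative terms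
    \<open>c * N + d\<close> since \<open>N \<ge> 1\<close>.\<close>
  define N where "N = 1 + (- c - d) / a"
  have N: "N \<ge> 1" "a * N = a - c - d"
    using assms by (auto simp: N_def field_simps)
  have "c * N\<^sup>2 \<le> c * N" "d * N\<^sup>2 \<le> d"
    using N assms mult_mono[of 1 N 1 N] by (auto simp: power2_eq_square mult_le_cancel_left)
  moreover have "p N = (a * N) * N\<^sup>2 + b * N\<^sup>2 + c * N + d"
    by (simp add: p_def power2_eq_square power3_eq_cube)
  moreover have "(a * N) * N\<^sup>2 = a * N\<^sup>2 - c * N\<^sup>2 - d * N\<^sup>2"
    unfolding N(2) by (simp add: algebra_simps)
  moreover have "0 \<le> a * N\<^sup>2" "0 \<le> b * N\<^sup>2"
    using assms by auto
  ultimately have "0 \<le> p N"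
    by linarith
  moreover have "p 0 < 0"
    using assms by (simp add: p_def)
  ultimately obtain X where X: "0 \<le> X" "X \<le> N" "p X = 0"
    using IVT'[of p 0 0 N] N unfolding p_def by (force intro!: continuous_intros)
  with \<open>p 0 < 0\<close> have "X \<noteq> 0"
    by auto
  with X show ?thesis
    by (intro that[of X]) (auto simp: p_def)
qed

text \<open>With p the cubic, X p(x) - x p(X) has no linear coefficient left and is divisible by x -
  X. The quotient \<open>K\<close> is positive, so p(x) has the sign of x - X.\<close>

lemma cubic_neg_iff_less_root:
  fixes a b c d :: real
  assumes "a > 0" "b \<ge> 0" "d < 0" and X: "X > 0" "a * X ^ 3 + b * X\<^sup>2 + c * X + d = 0"
    and x: "x > 0"
  shows "a * x ^ 3 + b * x\<^sup>2 + c * x + d < 0 \<longleftrightarrow> x < X"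
proof -
  define K where "K = a * x * X * (x + X) + b * x * X - d"
  have "K > 0"
  proof -
    have "0 < a * x * X * (x + X)" "0 \<le> b * x * X"
      using assms by simp_all
    then show ?thesis
      using \<open>d < 0\<close> unfolding K_def by linarith
  qed
  have "X * (a * x ^ 3 + b * x\<^sup>2 + c * x + d) - x * (a * X ^ 3 + b * X\<^sup>2 + c * X + d) = (x - X) * K"
    unfolding K_def by (simp add: algebra_simps power2_eq_square power3_eq_cube)
  then have "X * (a * x ^ 3 + b * x\<^sup>2 + c * x + d) = (x - X) * K"
    using X by simp
  then show ?thesis
    using X \<open>K > 0\<close> by (smt (verit) mult_less_0_iff)
qed

lemma cubic_root_cardano:
  fixes a b c d u v w X :: real
  assumes "a > 0" "b \<ge> 0" "c < 0" "d < 0"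
    and X: "X > 0" "a * X ^ 3 + b * X\<^sup>2 + c * X + d = 0"
    and u: "u = - (b / (3 * a))"
    and v: "v = u ^ 3 + (b * c - 3 * a * d) / (6 * a\<^sup>2)"
    and w: "w = c / (3 * a)"
  shows "of_real u + cbrt (of_real v - csqrt (of_real (v\<^sup>2 + (w - u\<^sup>2) ^ 3)))
       + cbrt (of_real v + csqrt (of_real (v\<^sup>2 + (w - u\<^sup>2) ^ 3))) = of_real X"
proof -
  define q Y where "q = w - u\<^sup>2" and "Y = X - u"
  \<comment> \<open>Solving for \<open>b\<close>, \<open>c\<close> and \<open>d\<close> in terms of
    \<open>a\<close>, \<open>u\<close>, \<open>v\<close>, \<open>w\<close> turns the shift by
    \<open>u\<close> into a polynomial identity.\<close>
  have b: "b = - 3 * a * u" and c: "c = 3 * a * w"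
    using assms by (auto simp: field_simps)
  have "(b * c - 3 * a * d) / (6 * a\<^sup>2) = - (3 * u * w + d / a) / 2"
    using \<open>a > 0\<close> unfolding b c by (simp add: field_simps power2_eq_square)
  then have "v = u ^ 3 + - (3 * u * w + d / a) / 2"
    by (simp only: v)
  then have "d / a = 2 * u ^ 3 - 3 * u * w - 2 * v"
    by argo
  then have d: "d = a * (2 * u ^ 3 - 3 * u * w - 2 * v)"
    using \<open>a > 0\<close> by (simp add: divide_eq_eq mult.commute)
  have "a * (Y ^ 3 + 3 * q * Y - 2 * v) = a * X ^ 3 + b * X\<^sup>2 + c * X + d"
    unfolding Y_def q_def b c d by (simp add: algebra_simps power2_eq_square power3_eq_cube)
  then have root: "Y ^ 3 + 3 * q * Y - 2 * v = 0"
    using X \<open>a > 0\<close> by simp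
  have "u \<le> 0" "w < 0"
    using assms(1-3) by (simp_all add: u w divide_neg_pos)
  then have "q < 0" "Y > 0"
    using X by (auto simp: q_def Y_def intro: less_le_trans[of _ 0])
  \<comment> \<open>The left side is X p'(X) for the cubic p. Subtracting p(X) = 0 removes the
    negative linear term and leaves only nonnegative ones, including \<open>- d > 0\<close>.\<close>
  have "3 * a * X * (Y\<^sup>2 + q) = 2 * a * X ^ 3 + b * X\<^sup>2 - d + (a * X ^ 3 + b * X\<^sup>2 + c * X + d)"
    unfolding Y_def q_def b c by (simp add: algebra_simps power2_eq_square power3_eq_cube)
  also have "\<dots> > 0"
  proof -
    have "0 < 2 * a * X ^ 3" "0 \<le> b * X\<^sup>2"
      using assms by simp_all
    then show ?thesis
      using X \<open>d < 0\<close> by linarith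
  qed
  finally have "Y\<^sup>2 + q > 0"
    using X \<open>a > 0\<close> by (auto dest!: zero_less_mult_pos)
  then show ?thesis
    using cardano_principal_roots[OF \<open>q < 0\<close> \<open>Y > 0\<close> _ root]
    by (simp add: add.assoc q_def Y_def)
qed

theorem proposition2:
  fixes P B \<sigma> \<xi> \<psi> \<gamma>\<^sub>2 \<gamma>\<^sub>4 \<alpha> l\<^sub>o l\<^sub>c t\<^sub>e t\<^sub>d :: real
    and \<epsilon> \<epsilon>\<^sub>o :: "real \<Rightarrow> real"
    and \<epsilon>\<^sub>c a b c d u v w :: real
    and S :: "real set"
  assumes "P > 0" and "B > 0" and "\<sigma>\<^sup>2 > 0" and "\<xi> > 0" and "\<psi> > 0"
    and "\<gamma>\<^sub>2 > 0" and "\<gamma>\<^sub>4 > 0" and "\<alpha> > 2"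
    and "l\<^sub>o > 0" and "l\<^sub>c \<ge> 0"
    and "0 < t\<^sub>e" and "t\<^sub>e < 1" and "t\<^sub>d = 1 - t\<^sub>e"
    and "\<And>r. r > 0 \<Longrightarrow> \<epsilon> r =
           t\<^sub>e * (\<gamma>\<^sub>2 * P / r powr \<alpha> + 3 / 2 * (\<gamma>\<^sub>4 * P\<^sup>2 / r powr (2 * \<alpha>)))"
    and "\<And>r. r > 0 \<Longrightarrow> \<epsilon>\<^sub>o r =
           (2 powr (l\<^sub>o / (t\<^sub>d * B)) - 1) * t\<^sub>d * \<sigma>\<^sup>2 * r powr \<alpha>"
    and "\<epsilon>\<^sub>c = \<xi> * \<psi> ^ 3 * l\<^sub>c ^ 3"
    and "S = {r. r > 0 \<and> \<epsilon> r > \<epsilon>\<^sub>o r + \<epsilon>\<^sub>c}"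
    and "a = (2 powr (l\<^sub>o / (t\<^sub>d * B)) - 1) * t\<^sub>d * \<sigma>\<^sup>2"
    and "b = l\<^sub>c ^ 3 * \<xi> * \<psi> ^ 3"
    and "c = - (t\<^sub>e * \<gamma>\<^sub>2 * P)"
    and "d = - (3 / 2 * t\<^sub>e * \<gamma>\<^sub>4 * P\<^sup>2)"
    and "u = - (b / (3 * a))"
    and "v = u ^ 3 + (b * c - 3 * a * d) / (6 * a\<^sup>2)"
    and "w = c / (3 * a)"
  shows "S \<noteq> {} \<and> bdd_above S \<and>
    complex_of_real (Sup S) =
      (complex_of_real u
        + cbrt (complex_of_real v - csqrt (complex_of_real (v\<^sup>2 + (w - u\<^sup>2) ^ 3)))
        + cbrt (complex_of_real v + csqrt (complex_of_real (v\<^sup>2 + (w - u\<^sup>2) ^ 3))))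
      powr (1 / complex_of_real \<alpha>)"
proof -
  have t\<^sub>d: "t\<^sub>d > 0"
    using assms by simp
  then have "2 powr (l\<^sub>o / (t\<^sub>d * B)) > 1"
    using assms by (simp add: gr_one_powr)
  then have sgn: "a > 0" "b \<ge> 0" "c < 0" "d < 0"
    using assms t\<^sub>d by auto
  obtain X where X: "X > 0" "a * X ^ 3 + b * X\<^sup>2 + c * X + d = 0"
    using cubic_positive_root_exists[OF sgn] by blast
  have iff: "\<epsilon> r > \<epsilon>\<^sub>o r + \<epsilon>\<^sub>c \<longleftrightarrow> r < X powr (1 / \<alpha>)" if "r > 0" for r
  proof -
    define x where "x = r powr \<alpha>"
    have x: "x > 0"
      using that by (simp add: x_def)
    have x2: "r powr (2 * \<alpha>) = x\<^sup>2"
      using that by (simp add: x_def power2_eq_square flip: powr_add)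
    have e: "\<epsilon> r = - (c * x + d) / x\<^sup>2" "\<epsilon>\<^sub>o r = a * x" "\<epsilon>\<^sub>c = b"
      using x that assms(14)[of r] assms(15)[of r] unfolding x2
      by (simp_all add: assms(16,18-21) flip: x_def) (simp add: field_simps power2_eq_square)
    \<comment> \<open>Multiplying by \<open>x\<^sup>2 > 0\<close> clears the denominators of the
      harvested energy.\<close>
    have "\<epsilon> r > \<epsilon>\<^sub>o r + \<epsilon>\<^sub>c \<longleftrightarrow> a * x ^ 3 + b * x\<^sup>2 + c * x + d < 0"
    proof -
      have "\<epsilon> r > \<epsilon>\<^sub>o r + \<epsilon>\<^sub>c \<longleftrightarrow> (a * x + b) * x\<^sup>2 < - (c * x + d)"
        using x unfolding e by (simp add: pos_less_divide_eq)
      also have "(a * x + b) * x\<^sup>2 = a * x ^ 3 + b * x\<^sup>2"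
        by (simp add: algebra_simps power2_eq_square power3_eq_cube)
      finally show ?thesis
        by auto
    qed
    also have "\<dots> \<longleftrightarrow> x < X"
      using cubic_neg_iff_less_root[OF sgn(1,2,4) X x] .
    also have "\<dots> \<longleftrightarrow> r < X powr (1 / \<alpha>)"
    proof -
      have "x < X \<longleftrightarrow> r powr \<alpha> < (X powr (1 / \<alpha>)) powr \<alpha>"
        using X assms(8) by (simp add: x_def powr_powr)
      also have "\<dots> \<longleftrightarrow> r < X powr (1 / \<alpha>)"
        using that assms(8) X by (auto intro: powr_less_mono2 powr_less_cancel2[of \<alpha>])
      finally show ?thesis .
    qed
    finally show ?thesis .
  qed
  then have S: "S = {0<..<X powr (1 / \<alpha>)}"
    unfolding assms(17) by auto
  have "X powr (1 / \<alpha>) > 0"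
    using X by simp
  moreover from this have "Sup S = X powr (1 / \<alpha>)"
    unfolding S by (simp add: cSup_greaterThanLessThan)
  \<comment> \<open>The base is a positive real, so the principal complex power agrees with the real
    one.\<close>
  moreover have "complex_of_real (X powr (1 / \<alpha>)) = of_real X powr (1 / of_real \<alpha>)"
    using X powr_of_real[of X "1 / \<alpha>"] by simp
  ultimately show ?thesis
    unfolding cubic_root_cardano[OF sgn X assms(22-24)] by (simp add: S)
qed

end
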